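(* Let $Q$ be a finite nonempty commutative kei. Then the order $|Q|$ is a power of $3$, i.e. $|Q|=3^m$ for some integer $m\ge 0$.
   Context: A kei (also called an involutory quandle) is a set $Q$ with a binary operation $*\colon Q\times Q\to Q$ such that for all $a,b,c\in Q$: (i) $a*a=a$; (ii) $(a*b)*b=a$; (iii) $(a*b)*c=(a*c)*(b*c)$. A kei is commutative if $a*b=b*a$ for all $a,b\in Q$ (equivalently, $a=(b*a)*b$ for all $a,b\in Q$). *)

theory Defs
  imports Main
begin

locale kei =
  fixes Q :: "'a set" and kop :: "'a \<Rightarrow> 'a \<Rightarrow> 'a" (infixl "\<star>" 70)
  assumes closed: "\<lbrakk>a \<in> Q; b \<in> Q\<rbrakk> \<Longrightarrow> a \<star> b \<in> Q"
    and idem: "a \<in> Q \<Longrightarrow> a \<star> a = a"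
    and invol: "\<lbrakk>a \<in> Q; b \<in> Q\<rbrakk> \<Longrightarrow> (a \<star> b) \<star> b = a"
    and distrib: "\<lbrakk>a \<in> Q; b \<in> Q; c \<in> Q\<rbrakk> \<Longrightarrow> (a \<star> b) \<star> c = (a \<star> c) \<star> (b \<star> c)"

locale commutative_kei = kei +
  assumes comm: "\<lbrakk>a \<in> Q; b \<in> Q\<rbrakk> \<Longrightarrow> a \<star> b = b \<star> a"

end

theory Submission
  imports Defs
    "HOL-Algebra.Sylow"
    "HOL-Algebra.Group_Action"
    "HOL-Algebra.Generated_Groups"
    "HOL-Algebra.Multiplicative_Group"
    "HOL-Combinatorics.Permutations"
begin

text \<open>For a point \<open>x\<close> of a commutative kei \<open>Q\<close> let \<open>S\<^bsub>x\<^esub>\<close> be the map \<open>y \<mapsto> x \<star> y\<close>, an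
  involutory automorphism; the points \<open>x\<close>, \<open>y\<close> and \<open>x \<star> y\<close> behave like a line over the field
  with three elements. The products \<open>S\<^bsub>x\<^esub> S\<^bsub>y\<^esub>\<close> play the role of translations. They have order
  dividing \<open>3\<close> and generate a group that acts transitively on \<open>Q\<close>. If that group is a
  \<open>3\<close>-group, the order of \<open>Q\<close>, being the length of an orbit, is a power of \<open>3\<close>
  (\<open>card_power_of_3\<close>).

  By the Baer-Suzuki theorem (\<open>baer_suzuki\<close>) a conjugation-invariant set of elements of a finite
  group generates a \<open>3\<close>-group as soon as any two of its elements do. This reduces the problem
  to two products of two reflections, hence to the group generated by the translations
  \<open>T\<^bsub>x\<^esub> = S\<^bsub>x\<^esub> S\<^bsub>a\<^esub>\<close> for three points \<open>x\<close> and a fixed fourth point \<open>a\<close>.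

  That group is nilpotent and generated by elements of order dividing \<open>3\<close>
  (\<open>p_subgroup_three_translations\<close>). The reason is an identity in four variables. The commutator
  of two translations \<open>T\<^bsub>b\<^esub>\<close> and \<open>T\<^bsub>c\<^esub>\<close> is, up to orientation, the automorphism
  \<open>(S\<^bsub>a\<^esub> S\<^bsub>b\<^esub> S\<^bsub>c\<^esub>)\<^sup>2\<close>, called a turn; it fixes \<open>a\<close>, \<open>b\<close> and \<open>c\<close> and moves a fourth point \<open>e\<close> by
  a vector, called the shift. The shift is alternating in \<open>b\<close>, \<open>c\<close> and \<open>e\<close> (it is the associator
  of the commutative Moufang loop attached to \<open>Q\<close> with origin \<open>a\<close>), and this forces it to be
  central in the subkei generated by the four points (\<open>turn_by_shift\<close>). So the translations commute
  modulo turns, the turns are central modulo the translations by shifts, and the latter are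
  central up to automorphisms that fix the four points.\<close>

section \<open>Subgroups of prime power order\<close>

context group
begin

lemma inv_mult_cancel:
  assumes "x \<in> carrier G" "y \<in> carrier G"
  shows "inv x \<otimes> (x \<otimes> y) = y" "x \<otimes> (inv x \<otimes> y) = y"
  using assms by (simp_all flip: m_assoc)

lemmas word_simps = m_assoc inv_mult_group inv_mult_cancel

lemma group_actionI:
  assumes closed: "\<And>g x. g \<in> carrier G \<Longrightarrow> x \<in> E \<Longrightarrow> act g x \<in> E"
    and one: "\<And>x. x \<in> E \<Longrightarrow> act \<one> x = x"
    and mult: "\<And>g h x. g \<in> carrier G \<Longrightarrow> h \<in> carrier G \<Longrightarrow> x \<in> E \<Longrightarrow> act (g \<otimes> h) x = act g (act h x)"
  shows "group_action G E (\<lambda>g. \<lambda>x\<in>E. act g x)"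
proof -
  have bij: "(\<lambda>x\<in>E. act g x) \<in> Bij E" if g: "g \<in> carrier G" for g
  proof -
    have "bij_betw (act g) E E"
    proof (rule bij_betw_byWitness[where f' = "act (inv g)"])
      show "\<forall>x\<in>E. act (inv g) (act g x) = x" "\<forall>x\<in>E. act g (act (inv g) x) = x"
        using g mult[of "inv g" g] mult[of g "inv g"] one by simp_all
    qed (use g closed in auto)
    then show ?thesis by (simp add: Bij_def)
  qed
  show ?thesis
  proof (intro group_action.intro group_hom.intro group_hom_axioms.intro homI)
    fix g h assume gh: "g \<in> carrier G" "h \<in> carrier G"
    show "(\<lambda>x\<in>E. act (g \<otimes> h) x) = (\<lambda>x\<in>E. act g x) \<otimes>\<^bsub>BijGroup E\<^esub> (\<lambda>x\<in>E. act h x)"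
      using gh bij closed mult by (fastforce simp: BijGroup_def compose_def)
  qed (use bij group_BijGroup in \<open>auto simp: BijGroup_def is_group\<close>)
qed

lemma orbit_card_dvd:
  assumes "group_action G E \<phi>" "x \<in> E"
  shows "card (orbit G \<phi> x) dvd order G"
  using group_action.orbit_stabilizer_theorem[OF assms] by (metis dvd_triv_left)

text \<open>All orbits have \<open>p\<close>-power length. If none had length one, \<open>p\<close> would divide every
  orbit length and hence the size of the whole set.\<close>

lemma p_group_fixed_point:
  assumes act: "group_action G E \<phi>" and fin: "finite E" and p: "prime p"
    and ord: "order G = p ^ k" and card: "\<not> p dvd card E"
  shows "\<exists>x\<in>E. \<forall>g\<in>carrier G. \<phi> g x = x"
proof (rule ccontr)
  assume none: "\<not> ?thesis"
  have orb: "p dvd card (orbit G \<phi> x)" if x: "x \<in> E" for x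
  proof -
    obtain i where i: "card (orbit G \<phi> x) = p ^ i"
      using orbit_card_dvd[OF act x] ord divides_primepow_nat[OF p] by auto
    obtain g where g: "g \<in> carrier G" "\<phi> g x \<noteq> x" using none x by blast
    have "x \<in> orbit G \<phi> x" "\<phi> g x \<in> orbit G \<phi> x"
      using group_action.orbit_refl[OF act x] g by (auto simp: orbit_def)
    then have "card (orbit G \<phi> x) \<noteq> 1" using g(2) by (metis card_1_singletonE singletonD)
    then show ?thesis using i by (cases i) auto
  qed
  have "card E = (\<Sum>C\<in>orbits G E \<phi>. card C)"
    using group_action.disjoint_sum[OF act fin, of "\<lambda>_. 1::nat"] by simp
  moreover have "p dvd (\<Sum>C\<in>orbits G E \<phi>. card C)"
    using orb by (intro dvd_sum) (auto simp: orbits_def)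
  ultimately show False using card by simp
qed

text \<open>The \<open>p\<close>-groups are described by the orders of their elements rather than by their
  cardinality: in this form a product of two \<open>p\<close>-subgroups, one normalizing the other, is
  seen to be a \<open>p\<close>-subgroup without counting anything. Cardinalities come back with
  \<open>order_p_group\<close>.\<close>

definition p_element :: "nat \<Rightarrow> 'a \<Rightarrow> bool" where
  "p_element p x \<longleftrightarrow> (\<exists>k. x [^] (p ^ k) = \<one>)"

definition p_subgroup :: "nat \<Rightarrow> 'a set \<Rightarrow> bool" where
  "p_subgroup p P \<longleftrightarrow> subgroup P G \<and> (\<forall>x\<in>P. p_element p x)"

text \<open>If a prime \<open>q \<noteq> p\<close> divided the order, Sylow's theorem for the first power of \<open>q\<close>
  would give an element whose order is \<open>q\<close> and at the same time a power of \<open>p\<close>.\<close>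

lemma order_p_group:
  assumes fin: "finite (carrier G)" and p: "prime p" and el: "\<forall>x\<in>carrier G. p_element p x"
  shows "\<exists>k. order G = p ^ k"
proof -
  have "order G > 0" using fin by (simp add: order_gt_0_iff_finite)
  from prime_power_canonical[OF p this] obtain k m where km: "\<not> p dvd m" "order G = p ^ k * m"
    by (auto simp: mult.commute)
  have "m = 1"
  proof (rule ccontr)
    assume "m \<noteq> 1"
    then obtain q where q: "prime q" "q dvd m" using prime_factor_nat by blast
    then obtain r where "order G = q ^ 1 * r" using km by (metis dvd_def dvd_mult power_one_right)
    then obtain H where H: "subgroup H G" "card H = q" using sylow_thm[OF q(1) is_group _ fin] by (metis power_one_right)
    have "card H \<noteq> 1" using H(2) q(1) by auto
    then obtain x where x: "x \<in> H" "x \<noteq> \<one>" using H(1)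
      by (metis is_singletonI' is_singleton_altdef subgroup.one_closed equals0D)
    then have xG: "x \<in> carrier G" using H(1) subgroup.subset by blast
    interpret H: group "G\<lparr>carrier := H\<rparr>" by (rule subgroup_imp_group[OF H(1)])
    have "x [^] q = \<one>"
      using H.pow_order_eq_1[of x] x(1) H by (simp add: order_def nat_pow_consistent[symmetric])
    then have "ord x dvd q" using pow_eq_id[OF xG] by blast
    moreover obtain j where "ord x dvd p ^ j" using el xG pow_eq_id[OF xG] by (auto simp: p_element_def)
    moreover have "coprime q (p ^ j)" for j using p q km(1) by (metis coprime_power_right_iff primes_coprime)
    ultimately have "ord x = 1" by (metis coprime_common_divisor_nat)
    then show False using x(2) ord_eq_1[OF xG] by simp
  qed
  then show ?thesis using km by auto
qed

lemma p_element_consistent: "group.p_element (G\<lparr>carrier := P\<rparr>) p x = p_element p x" if "subgroup P G"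
  unfolding group.p_element_def[OF subgroup_imp_group[OF that]] p_element_def
  by (simp add: nat_pow_consistent[symmetric])

lemma card_p_subgroup:
  assumes "finite (carrier G)" "prime p" "p_subgroup p P"
  shows "\<exists>k. card P = p ^ k"
proof -
  have P: "subgroup P G" using assms(3) by (simp add: p_subgroup_def)
  interpret P: group "G\<lparr>carrier := P\<rparr>" by (rule subgroup_imp_group[OF P])
  show ?thesis using P.order_p_group[of p] assms p_element_consistent[OF P] finite_subset[OF subgroup.subset[OF P]]
    by (simp add: order_def p_subgroup_def)
qed

lemma p_subgroup_subset: "p_subgroup p P \<Longrightarrow> subgroup K G \<Longrightarrow> K \<subseteq> P \<Longrightarrow> p_subgroup p K"
  by (auto simp: p_subgroup_def)

text \<open>Modulo \<open>N\<close> a power of \<open>n \<otimes> k\<close> is the same power of \<open>k\<close>. So a suitable \<open>p\<close>-power of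
  \<open>n \<otimes> k\<close> falls into \<open>N\<close>, and a further one is trivial.\<close>

lemma p_subgroup_mult:
  assumes N: "p_subgroup p N" and K: "p_subgroup p K"
    and norm: "\<And>k n. k \<in> K \<Longrightarrow> n \<in> N \<Longrightarrow> k \<otimes> n \<otimes> inv k \<in> N"
  shows "p_subgroup p (N <#> K)"
proof -
  interpret N: subgroup N G using N by (simp add: p_subgroup_def)
  interpret K: subgroup K G using K by (simp add: p_subgroup_def)
  have flip: "k \<otimes> n = (k \<otimes> n \<otimes> inv k) \<otimes> k" if "k \<in> K" "n \<in> N" for k n
    using that by (simp add: m_assoc)
  have prod: "(n \<otimes> k) \<otimes> (n' \<otimes> k') = (n \<otimes> (k \<otimes> n' \<otimes> inv k)) \<otimes> (k \<otimes> k')"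
    if "k \<in> K" "n \<in> N" "k' \<in> K" "n' \<in> N" for n k n' k'
    using that by (simp add: word_simps)
  have subgroup: "subgroup (N <#> K) G"
  proof (rule subgroupI)
    show "N <#> K \<subseteq> carrier G" by (auto simp: set_mult_def)
    have "\<one> \<otimes> \<one> \<in> N <#> K" unfolding set_mult_def using N.one_closed K.one_closed by blast
    then show "N <#> K \<noteq> {}" by blast
    fix x assume "x \<in> N <#> K"
    then obtain n k where x: "x = n \<otimes> k" "n \<in> N" "k \<in> K" by (auto simp: set_mult_def)
    have "inv x = (inv k \<otimes> inv n \<otimes> inv (inv k)) \<otimes> inv k" 
      using x by (simp add: word_simps)
    moreover have "inv k \<otimes> inv n \<otimes> inv (inv k) \<in> N" using x norm by blast
    ultimately show "inv x \<in> N <#> K" using x by (auto simp: set_mult_def)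
    fix y assume "y \<in> N <#> K"
    then obtain n' k' where y: "y = n' \<otimes> k'" "n' \<in> N" "k' \<in> K" by (auto simp: set_mult_def)
    have "x \<otimes> y = (n \<otimes> (k \<otimes> n' \<otimes> inv k)) \<otimes> (k \<otimes> k')" using prod x y by simp
    moreover have "n \<otimes> (k \<otimes> n' \<otimes> inv k) \<in> N" using x y norm by blast
    ultimately show "x \<otimes> y \<in> N <#> K" using x y by (auto simp: set_mult_def)
  qed
  moreover have "p_element p (n \<otimes> k)" if nk: "n \<in> N" "k \<in> K" for n k
  proof -
    have pow: "\<exists>n'\<in>N. (n \<otimes> k) [^] i = n' \<otimes> k [^] i" for i :: nat
    proof (induction i)
      case 0 show ?case by (auto intro!: bexI[of _ \<one>])
    next
      case (Suc i)
      then obtain n' where n': "n' \<in> N" "(n \<otimes> k) [^] i = n' \<otimes> k [^] i" by blast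
      have ki: "k [^] i \<in> K" using nk(2) by (induction i) auto
      show ?case using prod[OF ki n'(1) nk(2,1)] n' nk norm[OF ki nk(1)] by auto
    qed
    obtain i where i: "k [^] (p ^ i) = \<one>" using K nk(2) by (auto simp: p_subgroup_def p_element_def)
    obtain n' where n': "n' \<in> N" "(n \<otimes> k) [^] (p ^ i) = n'" using pow[of "p ^ i"] i by auto
    obtain j where "n' [^] (p ^ j) = \<one>" using N n'(1) by (auto simp: p_subgroup_def p_element_def)
    then have "(n \<otimes> k) [^] (p ^ (i + j)) = \<one>"
      using n' nk by (simp add: power_add nat_pow_pow[symmetric])
    then show ?thesis unfolding p_element_def by blast
  qed
  ultimately show ?thesis by (auto simp: p_subgroup_def set_mult_def)
qed

lemma p_subgroup_cyclic:
  assumes x: "x \<in> carrier G" and p: "p_element p x"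
  shows "p_subgroup p (generate G {x})"
proof -
  obtain k where k: "x [^] (p ^ k) = \<one>" using p by (auto simp: p_element_def)
  have "(x [^] i) [^] (p ^ k) = \<one>" for i :: int
  proof -
    have "(x [^] i) [^] int (p ^ k) = (x [^] int (p ^ k)) [^] i"
      by (simp only: int_pow_pow[OF x] mult.commute)
    then show ?thesis using k x by (simp only: int_pow_int int_pow_one)
  qed
  then show ?thesis using x generate_is_subgroup[of "{x}"] unfolding p_subgroup_def generate_pow[OF x] p_element_def by auto
qed

text \<open>Because of this lemma, \<open>g\<close> conjugates a generated subgroup into \<open>N\<close> as soon as it does
  so with the generators.\<close>

lemma conjugation_preimage_subgroup:
  assumes N: "subgroup N G" and g: "g \<in> carrier G"
  shows "subgroup {y \<in> carrier G. g \<otimes> y \<otimes> inv g \<in> N} G"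
proof -
  interpret N: subgroup N G by (rule N)
  show ?thesis
  proof (rule subgroupI)
    have "\<one> \<in> {y \<in> carrier G. g \<otimes> y \<otimes> inv g \<in> N}" using g by simp
    then show "{y \<in> carrier G. g \<otimes> y \<otimes> inv g \<in> N} \<noteq> {}" by blast
  next
    fix a assume a: "a \<in> {y \<in> carrier G. g \<otimes> y \<otimes> inv g \<in> N}"
    have "g \<otimes> inv a \<otimes> inv g = inv (g \<otimes> a \<otimes> inv g)"
      using a g by (simp add: word_simps)
    then show "inv a \<in> {y \<in> carrier G. g \<otimes> y \<otimes> inv g \<in> N}" using a by simp
    fix b assume b: "b \<in> {y \<in> carrier G. g \<otimes> y \<otimes> inv g \<in> N}"
    have "g \<otimes> (a \<otimes> b) \<otimes> inv g = (g \<otimes> a \<otimes> inv g) \<otimes> (g \<otimes> b \<otimes> inv g)"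
      using a b g by (simp add: word_simps)
    then show "a \<otimes> b \<in> {y \<in> carrier G. g \<otimes> y \<otimes> inv g \<in> N}" using a b by simp
  qed auto
qed

definition commutator :: "'a \<Rightarrow> 'a \<Rightarrow> 'a" where
  "commutator x y = x \<otimes> y \<otimes> inv x \<otimes> inv y"

lemma commutator_closed [simp]:
  "x \<in> carrier G \<Longrightarrow> y \<in> carrier G \<Longrightarrow> commutator x y \<in> carrier G"
  by (simp add: commutator_def)

text \<open>Modulo a subgroup \<open>N\<close> normalized by \<open>H\<close>, this is the centralizer of \<open>x\<close> in \<open>H\<close>; to be
  central modulo \<open>N\<close> it suffices to commute with generators. The proof rests on
  \<open>[x, ab] = [x, a] \<cdot> a [x, b] a\<inverse>\<close>.\<close>

lemma commutator_subgroup: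
  assumes N: "subgroup N G" and H: "subgroup H G" and x: "x \<in> carrier G"
    and norm: "\<And>g n. g \<in> H \<Longrightarrow> n \<in> N \<Longrightarrow> g \<otimes> n \<otimes> inv g \<in> N"
  shows "subgroup {g \<in> H. commutator x g \<in> N} G"
proof -
  interpret N: subgroup N G by (rule N)
  interpret H: subgroup H G by (rule H)
  show ?thesis
  proof (rule subgroupI)
    have "\<one> \<in> {g \<in> H. commutator x g \<in> N}" using x by (simp add: commutator_def)
    then show "{g \<in> H. commutator x g \<in> N} \<noteq> {}" by blast
  next
    fix a assume a: "a \<in> {g \<in> H. commutator x g \<in> N}"
    have "commutator x (inv a) = inv a \<otimes> inv (commutator x a) \<otimes> inv (inv a)"
      using a x by (simp add: word_simps commutator_def)
    then show "inv a \<in> {g \<in> H. commutator x g \<in> N}"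
      using a norm[of "inv a" "inv (commutator x a)"] by simp
    fix b assume b: "b \<in> {g \<in> H. commutator x g \<in> N}"
    have "commutator x (a \<otimes> b) = commutator x a \<otimes> (a \<otimes> commutator x b \<otimes> inv a)"
      using a b x by (simp add: word_simps commutator_def)
    then show "a \<otimes> b \<in> {g \<in> H. commutator x g \<in> N}" using a b norm by simp
  qed auto
qed

text \<open>Here \<open>N\<close> is a maximal normal \<open>p\<close>-subgroup of the group generated by \<open>X\<close>. A
  \<open>p\<close>-element \<open>x\<close> that is central modulo \<open>N\<close> generates together with \<open>N\<close> a normal
  \<open>p\<close>-subgroup again, hence lies in \<open>N\<close>. Applied repeatedly, this shows that a nilpotent
  group generated by \<open>p\<close>-elements is a \<open>p\<close>-group, by climbing the upper central series from
  the bottom, and no quotient group has to be formed.\<close>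

lemma p_core_absorbs:
  assumes fin: "finite (carrier G)" and X: "X \<subseteq> carrier G"
  shows "\<exists>N. p_subgroup p N \<and> N \<subseteq> generate G X \<and>
    (\<forall>g\<in>generate G X. \<forall>n\<in>N. g \<otimes> n \<otimes> inv g \<in> N) \<and>
    (\<forall>x\<in>generate G X. p_element p x \<longrightarrow> (\<forall>g\<in>X. commutator x g \<in> N) \<longrightarrow> x \<in> N)"
proof -
  define H where "H = generate G X"
  have H: "subgroup H G" unfolding H_def by (rule generate_is_subgroup[OF X])
  interpret H: subgroup H G by (rule H)
  define F where "F = {N. p_subgroup p N \<and> N \<subseteq> H \<and> (\<forall>g\<in>H. \<forall>n\<in>N. g \<otimes> n \<otimes> inv g \<in> N)}"
  have finF: "finite F" using fin finite_subset[OF H.subset] by (auto simp: F_def)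
  have "p_element p \<one>" by (simp add: p_element_def)
  then have "{\<one>} \<in> F" using triv_subgroup by (auto simp: F_def p_subgroup_def)
  then obtain N where N: "N \<in> F" and max: "\<And>M. M \<in> F \<Longrightarrow> N \<subseteq> M \<Longrightarrow> N = M"
    using finite_has_maximal2[OF finF] by metis
  have Np: "p_subgroup p N" and NH: "N \<subseteq> H" and norm: "\<And>g n. g \<in> H \<Longrightarrow> n \<in> N \<Longrightarrow> g \<otimes> n \<otimes> inv g \<in> N"
    using N by (auto simp: F_def)
  interpret N: subgroup N G using Np by (simp add: p_subgroup_def)
  have "x \<in> N" if x: "x \<in> H" "p_element p x" and comm: "\<And>g. g \<in> X \<Longrightarrow> commutator x g \<in> N" for x
  proof -
    have xG: "x \<in> carrier G" using x by simp
    define K where "K = generate G {x}"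
    have Kp: "p_subgroup p K" unfolding K_def by (rule p_subgroup_cyclic[OF xG x(2)])
    have KH: "K \<subseteq> H" unfolding K_def by (rule generate_subgroup_incl) (use x H in auto)
    interpret K: subgroup K G using Kp by (simp add: p_subgroup_def)
    have M: "p_subgroup p (N <#> K)" using p_subgroup_mult[OF Np Kp] norm KH by blast
    then interpret M: subgroup "N <#> K" G by (simp add: p_subgroup_def)
    have mult_mem: "n \<otimes> y \<in> N <#> K" if "n \<in> N" "y \<in> K" for n y
      using that unfolding set_mult_def by blast
    have NM: "N \<subseteq> N <#> K" using mult_mem[OF _ K.one_closed] by auto
    have "x \<in> K" unfolding K_def by (rule generate.incl) simp
    then have xM: "x \<in> N <#> K" using mult_mem[OF N.one_closed] xG by fastforce
    have "subgroup {g \<in> H. commutator x g \<in> N} G"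
      by (rule commutator_subgroup[OF N.subgroup_axioms H xG norm])
    moreover have "X \<subseteq> {g \<in> H. commutator x g \<in> N}"
      using comm X unfolding H_def by (auto intro: generate.incl)
    ultimately have "H \<subseteq> {g \<in> H. commutator x g \<in> N}"
      unfolding H_def by (rule generate_subgroup_incl[rotated])
    then have commH: "commutator x g \<in> N" if "g \<in> H" for g using that by blast
    have "g \<otimes> m \<otimes> inv g \<in> N <#> K" if g: "g \<in> H" and m: "m \<in> N <#> K" for g m
    proof -
      have gG: "g \<in> carrier G" using g by simp
      let ?S = "{y \<in> carrier G. g \<otimes> y \<otimes> inv g \<in> N <#> K}"
      have S: "subgroup ?S G" by (rule conjugation_preimage_subgroup[OF M.subgroup_axioms gG])
      have "g \<otimes> x \<otimes> inv g = inv (commutator x g) \<otimes> x"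
        using gG xG by (simp add: word_simps commutator_def)
      then have "x \<in> ?S" using commH[OF g] xG xM NM M.m_closed by auto
      then have "{x} \<subseteq> ?S" by blast
      from generate_subgroup_incl[OF this S] have "K \<subseteq> ?S" by (simp only: K_def)
      moreover have "N \<subseteq> ?S" using norm[OF g] NM by auto
      moreover obtain n y where ny: "m = n \<otimes> y" "n \<in> N" "y \<in> K" using m by (auto simp: set_mult_def)
      ultimately have "m \<in> ?S" using subgroup.m_closed[OF S, of n y] by blast
      then show ?thesis by blast
    qed
    moreover have "N <#> K \<subseteq> H" using NH KH by (auto simp: set_mult_def)
    ultimately have "N <#> K \<in> F" using M by (simp add: F_def)
    then show ?thesis using max[OF _ NM] xM by simp
  qed
  then show ?thesis using Np NH norm unfolding H_def by blast
qed

text \<open>When \<open>z = [x, y]\<close> commutes with \<open>x\<close>, the conjugate \<open>y x\<inverse> y\<inverse> = x\<inverse> z\<close> is a product of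
  two commuting factors; its cube and the cube of \<open>x\<inverse>\<close> are trivial, hence so is that
  of \<open>z\<close>.\<close>

lemma cube_of_commutator:
  assumes x: "x \<in> carrier G" "x [^] (3::nat) = \<one>" and y: "y \<in> carrier G"
    and comm: "commutator x y \<otimes> x = x \<otimes> commutator x y"
  shows "commutator x y [^] (3::nat) = \<one>"
proof -
  let ?z = "commutator x y"
  have "inv x \<otimes> ?z = y \<otimes> inv x \<otimes> inv y"
    using x y by (simp add: commutator_def word_simps)
  moreover have "inv x \<otimes> ?z = ?z \<otimes> inv x"
  proof -
    have "inv x \<otimes> (?z \<otimes> x) \<otimes> inv x = inv x \<otimes> (x \<otimes> ?z) \<otimes> inv x" using comm by simp
    then show ?thesis using x y by (simp add: word_simps)
  qed
  ultimately have "inv x [^] (3::nat) \<otimes> ?z [^] (3::nat) = (y \<otimes> inv x \<otimes> inv y) [^] (3::nat)"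
    using x y pow_mult_distrib[of "inv x" ?z 3] by simp
  also have "\<dots> = y \<otimes> inv x [^] (3::nat) \<otimes> inv y"
    using x y by (simp add: numeral_3_eq_3 word_simps)
  also have "inv x [^] (3::nat) = \<one>" using x by (simp add: nat_pow_inv)
  finally show ?thesis using x y by simp
qed

definition conj_set :: "'a \<Rightarrow> 'a set \<Rightarrow> 'a set" where
  "conj_set g A = (\<lambda>x. g \<otimes> x \<otimes> inv g) ` A"

lemma conj_set_closed: "g \<in> carrier G \<Longrightarrow> A \<subseteq> carrier G \<Longrightarrow> conj_set g A \<subseteq> carrier G"
  by (auto simp: conj_set_def)

lemma conj_set_one: "A \<subseteq> carrier G \<Longrightarrow> conj_set \<one> A = A"
  by (force simp: conj_set_def)

lemma conj_set_mult:
  assumes "g \<in> carrier G" "h \<in> carrier G" "A \<subseteq> carrier G"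
  shows "conj_set (g \<otimes> h) A = conj_set g (conj_set h A)"
  unfolding conj_set_def image_image
  by (rule image_cong) (use assms in \<open>auto simp: inv_mult_group m_assoc subset_iff\<close>)

lemma card_conj_set: "g \<in> carrier G \<Longrightarrow> A \<subseteq> carrier G \<Longrightarrow> card (conj_set g A) = card A"
  unfolding conj_set_def by (rule card_image) (auto simp: inj_on_def subset_iff)

text \<open>This is a form, for sets instead of subgroups, of the fact that normalizers grow in
  \<open>p\<close>-groups. The number of conjugates of \<open>D\<close> is a power of \<open>p\<close> other than \<open>1\<close>; the normalizer
  of \<open>D\<close> fixes \<open>D\<close>, hence another conjugate \<open>A\<close> as well. Then \<open>D\<close> and \<open>A\<close> have the same
  normalizer, for the two normalizers are conjugate and one contains the other. Since each
  element of \<open>A\<close> normalizes \<open>A\<close>, it also normalizes \<open>D\<close>; and \<open>A\<close>, being as large as \<open>D\<close>, is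
  not contained in it.\<close>

lemma p_group_normalizer_grows:
  assumes fin: "finite (carrier G)" and p: "prime p" and ord: "order G = p ^ k"
    and D: "D \<subseteq> carrier G" and self: "\<And>x. x \<in> D \<Longrightarrow> conj_set x D = D"
    and not_normal: "h \<in> carrier G" "conj_set h D \<noteq> D"
  shows "\<exists>g\<in>carrier G. \<exists>x\<in>conj_set g D. x \<notin> D \<and> conj_set x D = D"
proof -
  define E where "E = (\<lambda>g. conj_set g D) ` carrier G"
  have finE: "finite E" using fin by (simp add: E_def)
  have DE: "D \<in> E" unfolding E_def using conj_set_one[OF D] by force
  have E_sub: "A \<subseteq> carrier G" if "A \<in> E" for A using that conj_set_closed D by (auto simp: E_def)
  have actE: "conj_set g A \<in> E" if "g \<in> carrier G" "A \<in> E" for g A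
    using that D by (auto simp: E_def conj_set_mult[symmetric])
  have act: "group_action G E (\<lambda>g. \<lambda>A\<in>E. conj_set g A)"
    using actE E_sub by (intro group_actionI) (auto simp: conj_set_one conj_set_mult)
  have "orbit G (\<lambda>g. \<lambda>A\<in>E. conj_set g A) D = E" using DE by (auto simp: orbit_def E_def)
  then have "card E dvd p ^ k" using orbit_card_dvd[OF act DE] ord by simp
  then obtain i where i: "card E = p ^ i" using divides_primepow_nat[OF p] by blast
  have "conj_set h D \<in> E" using not_normal by (simp add: E_def)
  then have "card E \<noteq> 1" using not_normal DE by (metis card_1_singletonE singletonD)
  then have pE: "p dvd card E" using i by (cases i) auto
  (* The normalizer of D acts on the remaining conjugates, whose number is prime to p. *)
  define N where "N = {g \<in> carrier G. conj_set g D = D}"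
  have N_stab: "N = stabilizer G (\<lambda>g. \<lambda>A\<in>E. conj_set g A) D" using DE by (simp add: N_def stabilizer_def)
  have N: "subgroup N G" unfolding N_stab by (rule group_action.stabilizer_subgroup[OF act DE])
  have NG: "group (G\<lparr>carrier := N\<rparr>)" by (rule subgroup_imp_group[OF N])
  have "card N dvd p ^ k" using lagrange[OF N] ord by (metis dvd_triv_right)
  then obtain j where "card N = p ^ j"
    using divides_primepow_nat[OF p] by blast
  then have j: "order (G\<lparr>carrier := N\<rparr>) = p ^ j" by (simp add: order_def)
  have actN: "group_action (G\<lparr>carrier := N\<rparr>) (E - {D}) (\<lambda>g. \<lambda>A\<in>E - {D}. conj_set g A)"
  proof (rule group.group_actionI[OF NG, where act = conj_set])
    fix g A assume g: "g \<in> carrier (G\<lparr>carrier := N\<rparr>)" and A: "A \<in> E - {D}"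
    have gG: "g \<in> carrier G" and gD: "conj_set g D = D" using g unfolding N_def by auto
    have "conj_set (inv g) D = D"
      using conj_set_mult[of "inv g" g D] gG gD D conj_set_one by simp
    moreover have "conj_set (inv g) (conj_set g A) = A"
      using conj_set_mult[of "inv g" g A] gG A E_sub conj_set_one by simp
    ultimately show "conj_set g A \<in> E - {D}" using A gG actE by auto
  qed (use E_sub subgroup.mem_carrier[OF N] in \<open>auto simp: conj_set_one conj_set_mult\<close>)
  have "card E \<noteq> 0" using DE finE by auto
  then have "card E = Suc (card (E - {D}))" using DE finE by (metis card_Suc_Diff1)
  then have "\<not> p dvd card (E - {D})"
    using pE p by (metis Suc_eq_plus1 dvd_add_right_iff not_prime_unit)
  then obtain A where A: "A \<in> E - {D}" "\<forall>g\<in>N. conj_set g A = A"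
    using group.p_group_fixed_point[OF NG actN _ p j] finE by auto
  then obtain g where g: "g \<in> carrier G" "A = conj_set g D" by (auto simp: E_def)
  have gN: "conj_set (inv g) A = D"
    using conj_set_mult[of "inv g" g D] g D conj_set_one by simp
  have "conj_set (inv g) N \<subseteq> N"
  proof
    fix y assume "y \<in> conj_set (inv g) N"
    then obtain n where n: "n \<in> N" "y = inv g \<otimes> n \<otimes> inv (inv g)" by (auto simp: conj_set_def)
    have nG: "n \<in> carrier G" by (rule subgroup.mem_carrier[OF N n(1)])
    have "conj_set y D = conj_set (inv g \<otimes> n) (conj_set g D)"
      using n nG g D by (simp add: conj_set_mult[symmetric])
    also have "\<dots> = conj_set (inv g) (conj_set n A)"
      using n nG g D conj_set_closed by (simp add: conj_set_mult)
    finally show "y \<in> N" using n nG A(2) gN g by (simp add: N_def)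
  qed
  then have eq: "conj_set (inv g) N = N"
    using card_conj_set[of "inv g" N] g subgroup.subset[OF N] fin finite_subset by (metis card_subset_eq inv_closed)
  have "A \<subseteq> N"
  proof
    fix y assume "y \<in> A"
    then obtain x where x: "x \<in> D" "y = g \<otimes> x \<otimes> inv g" using g by (auto simp: conj_set_def)
    then have "x \<in> conj_set (inv g) N" using self D eq by (auto simp: N_def)
    then obtain n where "n \<in> N" "x = inv g \<otimes> n \<otimes> inv (inv g)" by (auto simp: conj_set_def)
    then show "y \<in> N" using x g subgroup.mem_carrier[OF N] by (simp add: word_simps)
  qed
  moreover have "\<not> A \<subseteq> D"
    using A(1) g card_conj_set[OF g(1) D] fin D finite_subset by (metis DiffD2 card_subset_eq singletonI)
  ultimately obtain x where x: "x \<in> A" "x \<notin> D" "x \<in> N" by blast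
  have "conj_set x D = D" using x(3) unfolding N_def by blast
  then show ?thesis using x(1,2) g by blast
qed

end

section \<open>The Baer-Suzuki theorem\<close>

context group
begin

text \<open>The argument is that of Alperin and Lyons. Consider the traces \<open>K \<inter> P\<close> of
  \<open>p\<close>-subgroups \<open>P\<close> that are maximal under inclusion. If there is only one, it is all of \<open>K\<close>,
  and \<open>K\<close> generates a \<open>p\<close>-group. Otherwise take two distinct ones, \<open>X\<close> and \<open>Y\<close>, with
  intersection \<open>D\<close> as large as possible. Inside a \<open>p\<close>-group normalizers grow, which provides
  \<open>x \<in> X\<close> and \<open>y \<in> Y\<close> outside \<open>D\<close> that normalize \<open>D\<close>. As \<open>x\<close> and \<open>y\<close> together generate a
  \<open>p\<close>-group, so do \<open>D\<close>, \<open>x\<close> and \<open>y\<close>; a maximal trace \<open>Z\<close> containing all of these meets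
  \<open>X\<close> and \<open>Y\<close> in more than \<open>D\<close>, so that \<open>X = Z = Y\<close>.\<close>

theorem baer_suzuki:
  assumes fin: "finite (carrier G)" and p: "prime p" and K: "K \<subseteq> carrier G"
    and conj: "\<And>g x. g \<in> carrier G \<Longrightarrow> x \<in> K \<Longrightarrow> g \<otimes> x \<otimes> inv g \<in> K"
    and pair: "\<And>x y. x \<in> K \<Longrightarrow> y \<in> K \<Longrightarrow> p_subgroup p (generate G {x, y})"
  shows "p_subgroup p (generate G K)"
proof -
  define F where "F = {K \<inter> P | P. p_subgroup p P}"
  define M where "M = {A \<in> F. \<forall>B\<in>F. A \<subseteq> B \<longrightarrow> A = B}"
  have finF: "finite F"
    by (rule finite_subset[of _ "Pow K"]) (use finite_subset[OF K fin] in \<open>auto simp: F_def\<close>)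
  have extend: "\<exists>B\<in>M. A \<subseteq> B" if A: "A \<in> F" for A
    using finite_has_maximal2[OF finF A] unfolding M_def by blast
  have normalizes: "conj_set g A = A"
    if g: "g \<in> carrier G" and A: "A \<subseteq> carrier G" and stable: "\<And>y. y \<in> A \<Longrightarrow> g \<otimes> y \<otimes> inv g \<in> A" for g A
    using card_conj_set[OF g A] stable finite_subset[OF A fin]
    by (intro card_subset_eq) (auto simp: conj_set_def)
  (* Either the whole p-subgroup normalizes D, or a conjugate of D supplies the element;
     that conjugate stays inside the trace because K is invariant under conjugation. *)
  have grow: "\<exists>x\<in>A - D. conj_set x D = D"
    if A: "A \<in> F" and B: "B \<in> F" and D: "D = A \<inter> B" and proper: "\<not> A \<subseteq> B" for A B D
  proof -
    obtain P where P: "p_subgroup p P" "A = K \<inter> P" using A by (auto simp: F_def)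
    obtain R where R: "p_subgroup p R" "B = K \<inter> R" using B by (auto simp: F_def)
    have sub: "subgroup P G" "subgroup R G" using P R by (simp_all add: p_subgroup_def)
    interpret P: subgroup P G by (rule sub)
    interpret R: subgroup R G by (rule sub)
    have PG: "group (G\<lparr>carrier := P\<rparr>)" by (rule subgroup_imp_group[OF sub(1)])
    have DG: "D \<subseteq> carrier G" using D P(2) K by auto
    have self: "conj_set x D = D" if "x \<in> D" for x
      using that D P(2) R(2) conj K DG by (intro normalizes) auto
    show ?thesis
    proof (cases "\<forall>h\<in>P. conj_set h D = D")
      case True
      then show ?thesis using proper P(2) D by auto
    next
      case False
      then obtain h where h: "h \<in> P" "conj_set h D \<noteq> D" by blast
      have conj_P: "group.conj_set (G\<lparr>carrier := P\<rparr>) g = conj_set g" if "g \<in> P" for g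
        using that sub(1) by (auto simp: group.conj_set_def[OF PG] conj_set_def m_inv_consistent fun_eq_iff)
      obtain k where k: "order (G\<lparr>carrier := P\<rparr>) = p ^ k"
        using card_p_subgroup[OF fin p P(1)] by (auto simp: order_def)
      have DP: "D \<subseteq> P" using D P(2) by auto
      have "\<exists>g\<in>P. \<exists>x\<in>conj_set g D. x \<notin> D \<and> group.conj_set (G\<lparr>carrier := P\<rparr>) x D = D"
        using group.p_group_normalizer_grows[OF PG _ p k, of D h] finite_subset[OF P.subset fin] DP self h conj_P
        by (auto simp: subset_iff)
      then obtain g x where gx: "g \<in> P" "x \<in> conj_set g D" "x \<notin> D" "group.conj_set (G\<lparr>carrier := P\<rparr>) x D = D"
        by blast
      have "x \<in> A" using gx(1,2) DP P(2) D conj by (auto simp: conj_set_def)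
      then show ?thesis using gx conj_P P(2) by auto
    qed
  qed
  have unique: "A = B" if AB: "A \<in> M" "B \<in> M" for A B
  proof (rule ccontr)
    assume "A \<noteq> B"
    define pairs where "pairs = {(A, B). A \<in> M \<and> B \<in> M \<and> A \<noteq> B}"
    have "(A, B) \<in> pairs" using AB \<open>A \<noteq> B\<close> by (simp add: pairs_def)
    moreover have "card (X \<inter> Y) \<le> card K" if "(X, Y) \<in> pairs" for X Y
      using that finite_subset[OF K fin] by (intro card_mono) (auto simp: pairs_def M_def F_def)
    ultimately have "\<exists>q. q \<in> pairs \<and> (\<forall>r. r \<in> pairs \<longrightarrow> card (fst r \<inter> snd r) \<le> card (fst q \<inter> snd q))"
      by (intro ex_has_greatest_nat[of _ "(A, B)" _ "Suc (card K)"]) (auto simp: less_Suc_eq_le)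
    then obtain X Y where XY: "(X, Y) \<in> pairs"
      and max: "\<And>X' Y'. (X', Y') \<in> pairs \<Longrightarrow> card (X' \<inter> Y') \<le> card (X \<inter> Y)"
      by fastforce
    define D where "D = X \<inter> Y"
    have F: "X \<in> F" "Y \<in> F" and maximal: "X \<in> M" "Y \<in> M" "X \<noteq> Y" using XY by (auto simp: pairs_def M_def)
    have "\<not> X \<subseteq> Y" "\<not> Y \<subseteq> X" using F maximal by (auto simp: M_def)
    then obtain x y where x: "x \<in> X - D" "conj_set x D = D" and y: "y \<in> Y - D" "conj_set y D = D"
      using grow[OF F] grow[OF F(2,1)] D_def by (metis Int_commute)
    obtain P where P: "p_subgroup p P" "X = K \<inter> P" using F(1) by (auto simp: F_def)
    have YK: "Y \<subseteq> K" using F(2) by (auto simp: F_def)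
    have xy: "x \<in> K" "y \<in> K" using x y P(2) YK by auto
    have DG: "D \<subseteq> carrier G" using D_def P(2) K by auto
    define U where "U = generate G D"
    define E where "E = generate G {x, y}"
    have U: "subgroup U G" unfolding U_def by (rule generate_is_subgroup[OF DG])
    have UP: "U \<subseteq> P" unfolding U_def
      by (rule generate_subgroup_incl) (use P in \<open>auto simp: D_def p_subgroup_def\<close>)
    have Up: "p_subgroup p U" by (rule p_subgroup_subset[OF P(1) U UP])
    have Ep: "p_subgroup p E" unfolding E_def by (rule pair[OF xy])
    have E: "subgroup E G" using Ep by (simp add: p_subgroup_def)
    define N where "N = {g \<in> carrier G. conj_set g D = D}"
    have "subgroup N G"
    proof (rule subgroupI)
      show "N \<noteq> {}" using conj_set_one[OF DG] unfolding N_def by blast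
      fix g assume g: "g \<in> N"
      then show "inv g \<in> N" using conj_set_mult[of "inv g" g D] DG conj_set_one by (auto simp: N_def)
      fix h assume "h \<in> N"
      then show "g \<otimes> h \<in> N" using g DG by (auto simp: N_def conj_set_mult)
    qed (auto simp: N_def)
    moreover have "{x, y} \<subseteq> N" using x y xy K by (auto simp: N_def)
    ultimately have EN: "E \<subseteq> N" unfolding E_def by (rule generate_subgroup_incl[rotated])
    have norm: "g \<otimes> u \<otimes> inv g \<in> U" if g: "g \<in> E" and u: "u \<in> U" for g u
    proof -
      have gG: "g \<in> carrier G" and gD: "conj_set g D = D" using g EN by (auto simp: N_def)
      have S: "subgroup {y \<in> carrier G. g \<otimes> y \<otimes> inv g \<in> U} G"
        by (rule conjugation_preimage_subgroup[OF U gG])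
      have "g \<otimes> d \<otimes> inv g \<in> D" if "d \<in> D" for d using that gD by (auto simp: conj_set_def)
      then have "D \<subseteq> {y \<in> carrier G. g \<otimes> y \<otimes> inv g \<in> U}"
        using DG unfolding U_def by (auto intro: generate.incl)
      from generate_subgroup_incl[OF this S] show ?thesis using u unfolding U_def by blast
    qed
    have W: "p_subgroup p (U <#> E)" by (rule p_subgroup_mult[OF Up Ep norm])
    then have "K \<inter> (U <#> E) \<in> F" by (auto simp: F_def)
    then obtain Z where Z: "Z \<in> M" "K \<inter> (U <#> E) \<subseteq> Z" using extend by blast
    have mult_mem: "u \<otimes> e \<in> U <#> E" if "u \<in> U" "e \<in> E" for u e
      using that unfolding set_mult_def by blast
    have "d \<in> U <#> E" if "d \<in> D" for d
    proof -
      have "d \<in> U" using that unfolding U_def by (rule generate.incl)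
      then have "d \<otimes> \<one> \<in> U <#> E" by (rule mult_mem[OF _ subgroup.one_closed[OF E]])
      then show ?thesis using that DG by auto
    qed
    then have DZ: "D \<subseteq> Z" using Z(2) P(2) D_def by auto
    have "e \<in> U <#> E" if "e \<in> {x, y}" for e
    proof -
      have "e \<in> E" using that unfolding E_def by (rule generate.incl)
      then have "\<one> \<otimes> e \<in> U <#> E" by (rule mult_mem[OF subgroup.one_closed[OF U]])
      then show ?thesis using that xy K by auto
    qed
    then have xyZ: "x \<in> Z" "y \<in> Z" using Z(2) xy by auto
    have absorb: "X' = Z" if X': "X' \<in> M" "D \<subseteq> X'" and z: "z \<in> X'" "z \<in> Z" "z \<notin> D" for X' z
    proof (rule ccontr)
      assume "X' \<noteq> Z"
      then have "card (X' \<inter> Z) \<le> card D" using max[of X' Z] X' Z(1) by (simp add: pairs_def D_def)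
      moreover have "D \<subset> X' \<inter> Z" using X' z DZ by auto
      moreover have "finite (X' \<inter> Z)" 
        using X'(1) finite_subset[OF K fin] by (auto simp: M_def F_def)
      ultimately show False by (meson not_le psubset_card_mono)
    qed
    have "X = Z" by (rule absorb[of X x]) (use maximal x xyZ in \<open>auto simp: D_def\<close>)
    moreover have "Y = Z" by (rule absorb[of Y y]) (use maximal y xyZ in \<open>auto simp: D_def\<close>)
    ultimately show False using maximal(3) by simp
  qed
  have "p_element p \<one>" by (simp add: p_element_def)
  then have "p_subgroup p {\<one>}" using triv_subgroup by (simp add: p_subgroup_def)
  then obtain A where A: "A \<in> M" using extend unfolding F_def by blast
  then obtain P where P: "p_subgroup p P" "A = K \<inter> P" by (auto simp: M_def F_def)
  have "K \<subseteq> P"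
  proof
    fix x assume x: "x \<in> K"
    have "K \<inter> generate G {x, x} \<in> F" using pair[OF x x] by (auto simp: F_def)
    then obtain B where B: "B \<in> M" "K \<inter> generate G {x, x} \<subseteq> B" using extend by blast
    have "x \<in> B" using B(2) x by (auto intro: generate.incl)
    then show "x \<in> P" using unique[OF A B(1)] P(2) by auto
  qed
  then have "generate G K \<subseteq> P" using P(1) by (intro generate_subgroup_incl) (auto simp: p_subgroup_def)
  then show ?thesis using p_subgroup_subset[OF P(1) generate_is_subgroup[OF K]] by simp
qed

end

section \<open>Associators in a commutative kei\<close>

context commutative_kei
begin

lemmas [simp] = closed idem

lemma cancel [simp]: "x \<in> Q \<Longrightarrow> y \<in> Q \<Longrightarrow> x \<star> (x \<star> y) = y"
  using comm invol by fastforce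

lemma cancel' [simp]: "x \<in> Q \<Longrightarrow> y \<in> Q \<Longrightarrow> x \<star> (y \<star> x) = y"
  using cancel comm by metis

lemma left_cancel: "x \<in> Q \<Longrightarrow> y \<in> Q \<Longrightarrow> z \<in> Q \<Longrightarrow> x \<star> y = x \<star> z \<longleftrightarrow> y = z"
  by (metis cancel)

lemma ldistrib: "x \<in> Q \<Longrightarrow> y \<in> Q \<Longrightarrow> z \<in> Q \<Longrightarrow> x \<star> (y \<star> z) = (x \<star> y) \<star> (x \<star> z)"
  using comm distrib closed by metis

text \<open>For the reflection \<open>S\<^bsub>x\<^esub> : y \<mapsto> x \<star> y\<close> this is the equation
  \<open>S\<^bsub>x \<star> y\<^esub> = S\<^bsub>x\<^esub> S\<^bsub>y\<^esub> S\<^bsub>x\<^esub>\<close>. Its left side is symmetric in \<open>x\<close> and \<open>y\<close>, which yields the braid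
  relation below.\<close>

lemma conjugate: "x \<in> Q \<Longrightarrow> y \<in> Q \<Longrightarrow> z \<in> Q \<Longrightarrow> (x \<star> y) \<star> z = x \<star> (y \<star> (x \<star> z))"
  using ldistrib cancel closed by metis

lemma braid: "x \<in> Q \<Longrightarrow> y \<in> Q \<Longrightarrow> z \<in> Q \<Longrightarrow> x \<star> (y \<star> (x \<star> z)) = y \<star> (x \<star> (y \<star> z))"
  using conjugate comm by metis

text \<open>This is \<open>(S\<^bsub>a\<^esub> S\<^bsub>b\<^esub> S\<^bsub>c\<^esub>)\<^sup>2\<close>. With \<open>a\<close> as origin, \<open>x + y = a \<star> (x \<star> y)\<close> is the addition of a
  commutative Moufang loop of exponent \<open>3\<close> in which \<open>- x = a \<star> x\<close>; the turn is the inner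
  mapping of that loop that measures how far \<open>b\<close> and \<open>c\<close> are from associating with the
  argument. In an affine space over the field with three elements it is the identity.\<close>

definition turn :: "'a \<Rightarrow> 'a \<Rightarrow> 'a \<Rightarrow> 'a \<Rightarrow> 'a" where
  "turn a b c x = a \<star> (b \<star> (c \<star> (a \<star> (b \<star> (c \<star> x)))))"

lemma turn_closed [simp]:
  "a \<in> Q \<Longrightarrow> b \<in> Q \<Longrightarrow> c \<in> Q \<Longrightarrow> x \<in> Q \<Longrightarrow> turn a b c x \<in> Q"
  by (simp add: turn_def)

lemma turn_hom:
  "a \<in> Q \<Longrightarrow> b \<in> Q \<Longrightarrow> c \<in> Q \<Longrightarrow> x \<in> Q \<Longrightarrow> y \<in> Q \<Longrightarrow> 
    turn a b c (x \<star> y) = turn a b c x \<star> turn a b c y"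
  by (simp add: turn_def flip: ldistrib)

lemma turn_reverse [simp]:
  "a \<in> Q \<Longrightarrow> b \<in> Q \<Longrightarrow> c \<in> Q \<Longrightarrow> x \<in> Q \<Longrightarrow> turn c b a (turn a b c x) = x"
  by (simp add: turn_def)

lemma turn_fixes_first [simp]:
  assumes "a \<in> Q" "b \<in> Q" "c \<in> Q"
  shows "turn a b c a = a"
proof -
  have "a \<star> (b \<star> (c \<star> a)) = a \<star> (b \<star> (a \<star> c))" using assms comm by simp
  also have "\<dots> = c \<star> (b \<star> a)" 
    using assms comm conjugate by (metis closed)
  finally show ?thesis using assms by (simp add: turn_def)
qed

lemma turn_fixes_second [simp]:
  assumes "a \<in> Q" "b \<in> Q" "c \<in> Q"
  shows "turn a b c b = b"
proof -
  have "a \<star> (b \<star> (c \<star> b)) = c \<star> a" using assms comm by simp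
  then show ?thesis using assms by (simp add: turn_def)
qed

lemma turn_fixes_third [simp]:
  assumes "a \<in> Q" "b \<in> Q" "c \<in> Q"
  shows "turn a b c c = c"
  using assms by (metis turn_fixes_first turn_reverse)

text \<open>Conjugating the square by \<open>S\<^bsub>a\<^esub>\<close> rotates its letters; but an automorphism that fixes \<open>a\<close>
  commutes with \<open>S\<^bsub>a\<^esub>\<close>.\<close>

lemma turn_rotate:
  assumes "a \<in> Q" "b \<in> Q" "c \<in> Q" "x \<in> Q"
  shows "turn b c a x = turn a b c x"
proof -
  have "turn a b c (a \<star> x) = a \<star> turn a b c x"
    using assms by (simp add: turn_hom)
  moreover have "turn a b c (a \<star> x) = a \<star> turn b c a x"
    by (simp add: turn_def)
  ultimately show ?thesis using assms left_cancel[of a "turn b c a x" "turn a b c x"] by simp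
qed

lemma turn_repeat: "a \<in> Q \<Longrightarrow> b \<in> Q \<Longrightarrow> x \<in> Q \<Longrightarrow> turn a b b x = x"
  by (simp add: turn_def)

text \<open>For \<open>f = e \<star> b\<close> this compares \<open>turn a c e\<close> with \<open>turn a b c\<close> at a common point, and so the
  action of the former on \<open>b\<close> with that of the latter on \<open>e\<close>. Combined with \<open>turn_rotate\<close> it
  says that reflecting one of the three defining points in \<open>f\<close> reverses the orientation of a
  turn, as far as \<open>f\<close> is concerned. The proof brings both sides to a common word in the
  reflections, using the braid relation and the rule \<open>S\<^bsub>x\<^esub> y = S\<^bsub>y\<^esub> x\<close>.\<close>

lemma turn_exchange:
  assumes "a \<in> Q" "b \<in> Q" "c \<in> Q" "f \<in> Q"
  shows "turn a c (f \<star> b) f = turn a b c f"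
proof -
  note [simp] = assms
  have "f \<star> (c \<star> (a \<star> b)) = (c \<star> (a \<star> b)) \<star> f"
    using comm[of f "c \<star> (a \<star> b)"] by simp
  also have "\<dots> = c \<star> (a \<star> (b \<star> (a \<star> (c \<star> f))))" by (simp add: conjugate)
  finally have swap: "f \<star> (c \<star> (a \<star> b)) = c \<star> (a \<star> (b \<star> (a \<star> (c \<star> f))))" .
  have "turn a c (f \<star> b) f = a \<star> (c \<star> (f \<star> (b \<star> (f \<star> (a \<star> (c \<star> b))))))"
    by (simp add: turn_def conjugate[of f b])
  also have "\<dots> = a \<star> (c \<star> (b \<star> (f \<star> (b \<star> (a \<star> (b \<star> c))))))"
    using comm[of c b] by (simp add: braid[of f b])
  also have "\<dots> = a \<star> (c \<star> (b \<star> (f \<star> (c \<star> (a \<star> b)))))"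
    using comm[of "b \<star> a" c] comm[of a b] by (simp flip: conjugate[of b a c])
  also have "\<dots> = turn a b c f" 
    unfolding turn_def swap by (simp add: braid[of c b] braid[of a b])
  finally show ?thesis .
qed

lemma turn_negate:
  assumes "a \<in> Q" "b \<in> Q" "c \<in> Q" "f \<in> Q"
  shows "turn a b (f \<star> c) f = turn b a c f"
  using turn_exchange[of a c b f] turn_rotate[of b a c f] assms by simp

text \<open>Reflecting all three defining points in \<open>f\<close> reflects the image of \<open>f\<close> under the turn,
  because \<open>S\<^bsub>f\<^esub>\<close> is an automorphism that fixes \<open>f\<close>. On the other hand it reverses the orientation
  three times.\<close>

lemma reflect_turn:
  assumes "a \<in> Q" "b \<in> Q" "c \<in> Q" "f \<in> Q"
  shows "f \<star> turn a b c f = turn c b a f"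
proof -
  note [simp] = assms
  have "f \<star> turn a b c f = turn (f \<star> a) (f \<star> b) (f \<star> c) (f \<star> f)"
    by (simp only: turn_def closed assms flip: ldistrib)
  also have "\<dots> = turn (f \<star> a) (f \<star> b) (f \<star> c) f" by simp
  also have "\<dots> = turn c b a f"
    using turn_negate turn_rotate by (metis closed assms)
  finally show ?thesis .
qed

text \<open>The orbit of \<open>f\<close> under a turn is thus a single line (or a point), and not a triangle.\<close>

lemma turn_turn:
  assumes "a \<in> Q" "b \<in> Q" "c \<in> Q" "f \<in> Q"
  shows "turn a b c (turn a b c f) = f \<star> turn a b c f"
  using reflect_turn[of a b c "turn a b c f"] assms comm cancel' by (metis turn_closed turn_reverse cancel)

text \<open>In the loop with origin \<open>a\<close> this is the difference of \<open>turn a b c e\<close> and \<open>e\<close>.\<close>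

definition shift :: "'a \<Rightarrow> 'a \<Rightarrow> 'a \<Rightarrow> 'a \<Rightarrow> 'a" where
  "shift a b c e = a \<star> (turn a b c e \<star> (a \<star> e))"

lemma shift_closed [simp]:
  "a \<in> Q \<Longrightarrow> b \<in> Q \<Longrightarrow> c \<in> Q \<Longrightarrow> e \<in> Q \<Longrightarrow> shift a b c e \<in> Q"
  by (simp add: shift_def)

lemma regroup:
  assumes "x \<in> Q" "y \<in> Q" "z \<in> Q" "u \<in> Q"
  shows "(x \<star> (y \<star> z)) \<star> (z \<star> u) = z \<star> (u \<star> ((x \<star> z) \<star> y))"
proof -
  note [simp] = assms
  have "(x \<star> (y \<star> z)) \<star> (z \<star> u) = z \<star> (u \<star> (z \<star> (x \<star> (y \<star> z))))"
    using comm[of "x \<star> (y \<star> z)" "z \<star> u"] by (simp add: conjugate)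
  also have "z \<star> (x \<star> (y \<star> z)) = (x \<star> z) \<star> y"
    using comm ldistrib by (metis assms cancel' closed)
  finally show ?thesis .
qed

text \<open>In the loop with origin \<open>a\<close> one has \<open>x \<star> y = - (x + y)\<close>. The two factors on the right are
  \<open>- (e + (b + c))\<close> and \<open>(e + b) + c\<close>, so that the shift is the difference of the two ways to
  bracket the sum of \<open>e\<close>, \<open>b\<close> and \<open>c\<close>. The proof moves the letters of the turn into place by
  applying \<open>regroup\<close> three times.\<close>

lemma shift_eq:
  assumes "a \<in> Q" "b \<in> Q" "c \<in> Q" "e \<in> Q"
  shows "shift a b c e = (e \<star> (a \<star> (b \<star> c))) \<star> ((a \<star> c) \<star> (e \<star> b))"
proof -
  note [simp] = assms
  have "shift a b c e = a \<star> ((a \<star> e) \<star> turn a b c e)"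
    unfolding shift_def using comm[of "a \<star> e" "turn a b c e"] by simp
  also have "\<dots> = e \<star> (b \<star> (c \<star> (a \<star> (b \<star> (c \<star> e)))))"
    by (simp add: conjugate turn_def)
  also have "c \<star> (a \<star> (b \<star> (c \<star> e))) = (e \<star> (a \<star> c)) \<star> (c \<star> (a \<star> b))"
    using regroup[of e a c "a \<star> b"] ldistrib[of a b "c \<star> e"] comm[of a c] comm[of e c] comm[of "c \<star> e" a]
    by simp
  also have "b \<star> \<dots> = (a \<star> (c \<star> b)) \<star> (b \<star> (e \<star> (a \<star> c)))"
    using regroup[of a c b "e \<star> (a \<star> c)"] comm[of c "a \<star> b"] by simp
  also have "e \<star> \<dots> = ((a \<star> c) \<star> (b \<star> e)) \<star> (e \<star> (a \<star> (c \<star> b)))"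
    using regroup[of "a \<star> c" b e "a \<star> (c \<star> b)"] comm[of "b" "e \<star> (a \<star> c)"] comm[of "a \<star> c" e] by simp
  also have "\<dots> = (e \<star> (a \<star> (b \<star> c))) \<star> ((a \<star> c) \<star> (e \<star> b))"
    using comm[of b c] comm[of b e] comm[of "e \<star> (a \<star> (b \<star> c))" "(a \<star> c) \<star> (e \<star> b)"] by simp
  finally show ?thesis .
qed

text \<open>Together with \<open>shift_swap_first\<close> this says that the shift is an alternating function of
  its last three arguments: a transposition negates it. This exchange merely interchanges the
  two bracketings of the sum of three elements, whereas the other one comes from
  \<open>reflect_turn\<close>.\<close>

lemma shift_swap_last:
  assumes "a \<in> Q" "b \<in> Q" "c \<in> Q" "e \<in> Q"
  shows "shift a b e c = a \<star> shift a b c e"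
  unfolding shift_eq[OF assms] shift_eq[OF assms(1,2,4,3)]
  using assms ldistrib comm by (smt (verit) cancel closed)

lemma shift_swap_first:
  assumes "a \<in> Q" "b \<in> Q" "c \<in> Q" "e \<in> Q"
  shows "shift a c b e = a \<star> shift a b c e"
proof -
  note [simp] = assms
  have "turn a c b e = e \<star> turn a b c e"
    using turn_rotate[of c b a e] reflect_turn[of a b c e] turn_rotate by (metis assms)
  then have "shift a c b e = a \<star> ((e \<star> turn a b c e) \<star> (e \<star> a))"
    using comm[of e a] by (simp add: shift_def)
  also have "\<dots> = a \<star> (e \<star> (a \<star> turn a b c e))"
    using comm[of "turn a b c e" a] by (simp flip: ldistrib)
  also have "\<dots> = turn a b c e \<star> (a \<star> e)"
    using comm[of "a \<star> e" "turn a b c e"] by (simp flip: conjugate)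
  finally show ?thesis by (simp add: shift_def)
qed

lemma shift_rotate:
  assumes "a \<in> Q" "b \<in> Q" "c \<in> Q" "e \<in> Q"
  shows "shift a c e b = shift a b c e"
  using assms by (simp add: shift_swap_last[of a c b e] shift_swap_first[of a b c e])

lemma turn_shift [simp]:
  assumes "a \<in> Q" "b \<in> Q" "c \<in> Q" "e \<in> Q"
  shows "turn a b c (shift a b c e) = shift a b c e"
proof -
  note [simp] = assms
  let ?f = "turn a b c e"
  have "turn a b c (shift a b c e) = a \<star> ((e \<star> ?f) \<star> (a \<star> ?f))"
    by (simp add: shift_def turn_hom turn_turn)
  also have "\<dots> = a \<star> (?f \<star> (a \<star> e))"
    using comm distrib by (metis assms closed turn_closed)
  finally show ?thesis by (simp add: shift_def)
qed

text \<open>The origin \<open>a\<close> is the zero of the loop. As the shift is alternating, the condition that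
  \<open>turn a b c\<close> fixes \<open>e\<close> is therefore symmetric in \<open>b\<close>, \<open>c\<close> and \<open>e\<close>.\<close>

lemma turn_fixes_iff_shift:
  assumes "a \<in> Q" "b \<in> Q" "c \<in> Q" "e \<in> Q"
  shows "turn a b c e = e \<longleftrightarrow> shift a b c e = a"
  unfolding shift_def using assms comm by (metis cancel cancel' closed idem turn_closed)

lemma turn_fixes_swap_last:
  assumes "a \<in> Q" "b \<in> Q" "c \<in> Q" "e \<in> Q"
  shows "turn a b e c = c \<longleftrightarrow> turn a b c e = e"
  using assms by (metis shift_swap_last turn_fixes_iff_shift idem cancel shift_closed)

lemma turn_fixes_swap_first:
  assumes "a \<in> Q" "b \<in> Q" "c \<in> Q" "e \<in> Q"
  shows "turn a c b e = e \<longleftrightarrow> turn a b c e = e"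
  using assms by (metis shift_swap_first turn_fixes_iff_shift idem cancel shift_closed)

text \<open>An associator \<open>t\<close> of three elements is central in the subloop that they generate. Indeed
  \<open>turn a b c\<close> fixes \<open>t\<close> by \<open>turn_shift\<close>; as \<open>t\<close> does not change when \<open>b\<close>, \<open>c\<close> and \<open>e\<close> are
  permuted cyclically, the turns through the other pairs fix it as well; and by symmetry the
  turns through \<open>t\<close> fix \<open>b\<close>, \<open>c\<close> and \<open>e\<close>.\<close>

lemma turn_by_shift:
  assumes "a \<in> Q" "b \<in> Q" "c \<in> Q" "e \<in> Q" and "u \<in> {b, c, e}" "v \<in> {b, c, e}"
  shows "turn a (shift a b c e) u v = v"
proof -
  note [simp] = assms(1-4)
  let ?t = "shift a b c e"
  have "turn a b c ?t = ?t" "turn a c e ?t = ?t" "turn a e b ?t = ?t"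
    using turn_shift[of a b c e] turn_shift[of a c e b] turn_shift[of a e b c] shift_rotate 
    by (metis assms(1-4))+
  then have "turn a ?t b c = c" "turn a ?t c e = e" "turn a ?t e b = b"
     "turn a ?t c b = b" "turn a ?t e c = c" "turn a ?t b e = e"
    using turn_fixes_swap_last turn_fixes_swap_first by (metis assms(1-4) shift_closed)+
  then show ?thesis using assms(5,6) by auto
qed

end

section \<open>Translations generate a 3-group\<close>

context commutative_kei
begin

definition Aut :: "('a \<Rightarrow> 'a) monoid" where
  "Aut = \<lparr>carrier = {f. f permutes Q \<and> (\<forall>x\<in>Q. \<forall>y\<in>Q. f (x \<star> y) = f x \<star> f y)},
          monoid.mult = (\<circ>), one = id\<rparr>"

lemma Aut_simps [simp]:
  "f \<in> carrier Aut \<longleftrightarrow> f permutes Q \<and> (\<forall>x\<in>Q. \<forall>y\<in>Q. f (x \<star> y) = f x \<star> f y)"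
  "f \<otimes>\<^bsub>Aut\<^esub> g = f \<circ> g" "\<one>\<^bsub>Aut\<^esub> = id"
  by (simp_all add: Aut_def)

lemma group_Aut: "group Aut"
proof (rule groupI)
  fix f assume f: "f \<in> carrier Aut"
  let ?g = "inv_into UNIV f"
  have "?g (x \<star> y) = ?g x \<star> ?g y" if "x \<in> Q" "y \<in> Q" for x y
  proof -
    have "f (?g x \<star> ?g y) = x \<star> y"
      using f that by (simp add: permutes_inverses[of f Q] permutes_in_image[OF permutes_inv])
    then show ?thesis using f by (metis Aut_simps(1) permutes_inverses(2))
  qed
  then show "\<exists>g\<in>carrier Aut. g \<otimes>\<^bsub>Aut\<^esub> f = \<one>\<^bsub>Aut\<^esub>"
    using f by (intro bexI[of _ ?g]) (auto simp: permutes_inv permutes_inv_o)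
qed (auto simp: permutes_compose permutes_id permutes_in_image comp_assoc)

interpretation Aut: group Aut by (rule group_Aut)

lemma finite_Aut: "finite Q \<Longrightarrow> finite (carrier Aut)"
  by (rule finite_subset[OF _ finite_permutations[of Q]]) auto

text \<open>Outside \<open>Q\<close> the reflection has to be the identity in order to be a permutation of \<open>Q\<close> on
  the whole type.\<close>

definition reflection :: "'a \<Rightarrow> 'a \<Rightarrow> 'a" where
  "reflection x = (\<lambda>y. if y \<in> Q then x \<star> y else y)"

lemma reflection_twice [simp]: "x \<in> Q \<Longrightarrow> reflection x (reflection x y) = y"
  by (simp add: reflection_def)

lemma reflection_comp_self [simp]: "x \<in> Q \<Longrightarrow> reflection x \<circ> reflection x = id"
  by (simp add: fun_eq_iff)

lemma reflection_in_Aut [simp]: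
  assumes "x \<in> Q" shows "reflection x permutes Q" "reflection x \<in> carrier Aut"
proof -
  have "bij_betw (reflection x) Q Q"
    by (rule bij_betw_byWitness[where f' = "reflection x"]) (use assms in \<open>auto simp: reflection_def\<close>)
  then show "reflection x permutes Q" by (rule bij_imp_permutes) (simp add: reflection_def)
  then show "reflection x \<in> carrier Aut" using assms by (simp add: reflection_def ldistrib[of x])
qed

text \<open>Conjugation by an automorphism moves reflections as it moves points. In particular an
  automorphism commutes with the reflections in its fixed points.\<close>

lemma Aut_comp_reflection: "f \<in> carrier Aut \<Longrightarrow> x \<in> Q \<Longrightarrow> f \<circ> reflection x = reflection (f x) \<circ> f"
  by (auto simp: fun_eq_iff reflection_def permutes_in_image)

lemma reflection_star: "x \<in> Q \<Longrightarrow> y \<in> Q \<Longrightarrow> reflection (x \<star> y) = reflection x \<circ> reflection y \<circ> reflection x"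
  by (auto simp: fun_eq_iff reflection_def conjugate)

definition translation :: "'a \<Rightarrow> 'a \<Rightarrow> 'a \<Rightarrow> 'a" where
  "translation a x = reflection x \<circ> reflection a"

lemma translation_in_Aut [simp]: "a \<in> Q \<Longrightarrow> x \<in> Q \<Longrightarrow> translation a x \<in> carrier Aut"
  unfolding translation_def using Aut.m_closed[of "reflection x" "reflection a"] by (simp del: Aut_simps(1) add: Aut_simps(2))

lemma inv_translation: "a \<in> Q \<Longrightarrow> x \<in> Q \<Longrightarrow> inv\<^bsub>Aut\<^esub> (translation a x) = translation x a"
  by (rule Aut.inv_equality[OF _ translation_in_Aut translation_in_Aut]) (simp add: translation_def fun_eq_iff)

lemma translation_self [simp]: "a \<in> Q \<Longrightarrow> translation a a = id"
  by (simp add: translation_def)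

text \<open>With \<open>T\<^bsub>x\<^esub>\<close> for \<open>translation a x\<close>, the right side is \<open>T\<^bsub>x\<^esub> T\<^bsub>y\<^esub>\<inverse> T\<^bsub>x\<^esub>\<close>. Hence the points
  whose translation lies in a given subgroup form a subkei.\<close>

lemma translation_star:
  "a \<in> Q \<Longrightarrow> x \<in> Q \<Longrightarrow> y \<in> Q \<Longrightarrow> translation a (x \<star> y) = translation a x \<circ> translation y a \<circ> translation a x"
  by (simp add: translation_def reflection_star fun_eq_iff)

lemma translation_cube:
  assumes "a \<in> Q" "x \<in> Q" shows "translation a x [^]\<^bsub>Aut\<^esub> (3::nat) = id"
proof -
  have "reflection x \<circ> reflection a \<circ> reflection x = reflection a \<circ> reflection x \<circ> reflection a"
    using reflection_star comm assms by metis
  then have "reflection x (reflection a (reflection x q)) = reflection a (reflection x (reflection a q))" for q by (simp add: fun_eq_iff)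
  then show ?thesis using assms by (simp add: numeral_3_eq_3 translation_def fun_eq_iff)
qed

text \<open>The commutator cancels to \<open>(S\<^bsub>x\<^esub> S\<^bsub>a\<^esub> S\<^bsub>y\<^esub>)\<^sup>2\<close>. This is what links the turns with the group
  structure.\<close>

lemma commutator_translation:
  assumes "a \<in> Q" "x \<in> Q" "y \<in> Q" "q \<in> Q"
  shows "Aut.commutator (translation a x) (translation a y) q = turn a y x q"
proof -
  have "Aut.commutator (translation a x) (translation a y) q = turn x a y q"
    using assms unfolding Aut.commutator_def inv_translation[OF assms(1,2)] inv_translation[OF assms(1,3)]
    by (simp add: translation_def turn_def) (simp add: reflection_def)
  then show ?thesis using assms turn_rotate[of y x a q] turn_rotate[of a y x q] by simp
qed

lemma commutator_Aut_translation:
  assumes "f \<in> carrier Aut" "a \<in> Q" "x \<in> Q" and "f a = a"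
  shows "Aut.commutator f (translation a x) = translation a (f x) \<circ> translation x a"
proof -
  have "f \<otimes>\<^bsub>Aut\<^esub> translation a x = translation a (f x) \<otimes>\<^bsub>Aut\<^esub> f"
    using Aut_comp_reflection[OF assms(1,2)] Aut_comp_reflection[OF assms(1,3)] assms(4) by (simp add: translation_def fun_eq_iff)
  moreover have "f x \<in> Q" using assms by (simp add: permutes_in_image)
  ultimately have "Aut.commutator f (translation a x) = translation a (f x) \<otimes>\<^bsub>Aut\<^esub> inv\<^bsub>Aut\<^esub> translation a x"
    using assms by (simp add: Aut.commutator_def Aut.m_assoc del: Aut_simps)
  then show ?thesis using assms by (simp add: inv_translation)
qed

lemma p_element_3: "f [^]\<^bsub>Aut\<^esub> (3::nat) = id \<Longrightarrow> Aut.p_element 3 f"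
  unfolding Aut.p_element_def by (intro exI[of _ 1]) simp

lemma turn_eq_shift:
  assumes "a \<in> Q" "b \<in> Q" "c \<in> Q" "e \<in> Q"
  shows "turn a b c e = a \<star> (shift a b c e \<star> e)"
proof -
  have "a \<star> (shift a b c e \<star> e) = (a \<star> shift a b c e) \<star> (a \<star> e)"
    using assms by (intro ldistrib) simp_all
  then show ?thesis using assms by (simp add: shift_def invol)
qed

text \<open>On the subkei generated by \<open>a\<close>, \<open>b\<close>, \<open>c\<close> and \<open>e\<close> the translations generate a nilpotent
  group of class at most three: by \<open>turn_by_shift\<close> the translation by a shift is central there,
  and modulo such translations the turns, which are the commutators of the generators, are
  central. On all of \<open>Q\<close> one more central layer appears, because automorphisms that fix the four
  points need not be trivial elsewhere. Each layer is generated by elements of order dividing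
  \<open>3\<close>, so all of them, and in the end the generators, are absorbed by the largest normal
  \<open>3\<close>-subgroup \<open>N\<close>.\<close>

lemma p_subgroup_three_translations:
  assumes fin: "finite Q" and Q: "a \<in> Q" "b \<in> Q" "c \<in> Q" "e \<in> Q"
  shows "Aut.p_subgroup 3 (generate Aut (translation a ` {b, c, e}))"
proof -
  define X where "X = {b, c, e}"
  define H where "H = generate Aut (translation a ` X)"
  have XQ: "x \<in> Q" if "x \<in> X" for x using that Q by (auto simp: X_def)
  have gens: "translation a ` X \<subseteq> carrier Aut" using XQ Q translation_in_Aut by blast
  have H: "subgroup H Aut" unfolding H_def by (rule Aut.generate_is_subgroup[OF gens])
  have TX: "translation a x \<in> H" if "x \<in> X" for x unfolding H_def using that by (auto intro: generate.incl)
  obtain N where N: "Aut.p_subgroup 3 N" "N \<subseteq> H"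
    and norm: "\<And>g n. g \<in> H \<Longrightarrow> n \<in> N \<Longrightarrow> g \<otimes>\<^bsub>Aut\<^esub> n \<otimes>\<^bsub>Aut\<^esub> inv\<^bsub>Aut\<^esub> g \<in> N"
    and core: "\<forall>f\<in>H. Aut.p_element 3 f \<longrightarrow> (\<forall>g\<in>translation a ` X. Aut.commutator f g \<in> N) \<longrightarrow> f \<in> N"
    using Aut.p_core_absorbs[OF finite_Aut[OF fin] gens, of 3, folded H_def] by blast
  have absorb: "f \<in> N" if "f \<in> H" "f [^]\<^bsub>Aut\<^esub> (3::nat) = id"
    and "\<And>x. x \<in> X \<Longrightarrow> Aut.commutator f (translation a x) \<in> N" for f
    using core that p_element_3 by blast
  have Nsub: "subgroup N Aut" using N by (simp add: Aut.p_subgroup_def)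
  have idN: "id \<in> N" using subgroup.one_closed[OF Nsub] by simp
  have TH_star: "translation a (x \<star> y) \<in> H" if "x \<in> Q" "y \<in> Q" "translation a x \<in> H" "translation a y \<in> H" for x y
  proof -
    have "translation a (x \<star> y) = translation a x \<otimes>\<^bsub>Aut\<^esub> inv\<^bsub>Aut\<^esub> translation a y \<otimes>\<^bsub>Aut\<^esub> translation a x"
      using that Q by (simp add: translation_star inv_translation)
    then show ?thesis using that H subgroup.m_closed subgroup.m_inv_closed by metis
  qed
  have THa: "translation a a \<in> H" using subgroup.one_closed[OF H] Q by simp
  have commH: "Aut.commutator f g \<in> H" if "f \<in> H" "g \<in> H" for f g
    using that H by (simp add: Aut.commutator_def subgroup.m_closed subgroup.m_inv_closed del: Aut_simps)
  have fixing: "Aut.commutator f (translation a x) = id" if "f \<in> carrier Aut" "f a = a" "f x = x" "x \<in> Q" for f x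
    using commutator_Aut_translation[OF that(1) Q(1) that(4,2)] that Q by (simp add: translation_def fun_eq_iff)
  have comm_cube: "Aut.commutator (translation a x) (translation a y) [^]\<^bsub>Aut\<^esub> (3::nat) = id" if xy: "x \<in> Q" "y \<in> Q" for x y
  proof -
    let ?w = "Aut.commutator (translation a x) (translation a y)"
    have w: "?w \<in> carrier Aut" using xy Q by (simp del: Aut_simps)
    have "?w a = a" "?w x = x" using xy Q by (simp_all add: commutator_translation)
    then have "?w \<circ> reflection a = reflection a \<circ> ?w" "?w \<circ> reflection x = reflection x \<circ> ?w"
      using Aut_comp_reflection[OF w] Q xy by metis+
    then have "?w \<otimes>\<^bsub>Aut\<^esub> translation a x = translation a x \<otimes>\<^bsub>Aut\<^esub> ?w"
      by (simp add: translation_def fun_eq_iff)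
    then have "?w [^]\<^bsub>Aut\<^esub> (3::nat) = \<one>\<^bsub>Aut\<^esub>"
      using Aut.cube_of_commutator[OF translation_in_Aut[OF Q(1) xy(1)] _ translation_in_Aut[OF Q(1) xy(2)]] 
        translation_cube[OF Q(1) xy(1)] by simp
    then show ?thesis by simp
  qed
  (* The commutators of the translation by a shift with the generators fix a, b, c and e;
     so they lie in N, and then the translation itself does. *)
  have shiftN: "translation a (shift a x y z) \<in> N" if X: "X = {x, y, z}" for x y z
  proof -
    let ?t = "shift a x y z"
    have xyz: "x \<in> Q" "y \<in> Q" "z \<in> Q" using X XQ by auto
    have tQ: "?t \<in> Q" using Q xyz by simp
    have tH: "translation a ?t \<in> H"
      unfolding shift_def turn_def by (intro TH_star closed THa TX Q xyz) (auto simp: X)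
    have comm_t: "Aut.commutator (translation a ?t) (translation a u) \<in> N" if u: "u \<in> X" for u
    proof (rule absorb)
      let ?k = "Aut.commutator (translation a ?t) (translation a u)"
      have uQ: "u \<in> Q" using u by (rule XQ)
      have k: "?k \<in> carrier Aut" using tQ Q uQ by (simp del: Aut_simps)
      show "?k \<in> H" by (intro commH tH TX u)
      show "?k [^]\<^bsub>Aut\<^esub> (3::nat) = id" by (rule comm_cube[OF tQ uQ])
      fix v assume v: "v \<in> X"
      have "turn a ?t u v = v" using turn_by_shift[OF Q(1) xyz] u v X by blast
      then have "?k v = v"
        using turn_fixes_swap_first[OF Q(1) tQ uQ XQ[OF v]] commutator_translation[OF Q(1) tQ uQ XQ[OF v]] by simp
      moreover have "?k a = a" using commutator_translation[OF Q(1) tQ uQ Q(1)] Q uQ tQ by simp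
      ultimately show "Aut.commutator ?k (translation a v) \<in> N" using fixing[OF k] XQ[OF v] idN by simp
    qed
    show ?thesis by (rule absorb[OF tH translation_cube[OF Q(1) tQ] comm_t])
  qed
  (* A turn commutes with two of the generators and moves the third one by a shift. *)
  have commN: "Aut.commutator (translation a x) (translation a y) \<in> N" if xy: "x \<in> X" "y \<in> X" for x y
  proof (rule absorb)
    let ?w = "Aut.commutator (translation a x) (translation a y)"
    have xyQ: "x \<in> Q" "y \<in> Q" using xy XQ by auto
    have w: "?w \<in> carrier Aut" using xyQ Q by (simp del: Aut_simps)
    have wq: "?w q = turn a y x q" if "q \<in> Q" for q by (rule commutator_translation[OF Q(1) xyQ that])
    show "?w \<in> H" by (intro commH TX xy)
    show "?w [^]\<^bsub>Aut\<^esub> (3::nat) = id" by (rule comm_cube[OF xyQ])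
    fix z assume z: "z \<in> X"
    have zQ: "z \<in> Q" using z by (rule XQ)
    have wa: "?w a = a" using wq Q xyQ by simp
    show "Aut.commutator ?w (translation a z) \<in> N"
    proof (cases "x = y \<or> z = x \<or> z = y")
      case True
      then have "?w z = z" using wq[OF zQ] Q xyQ zQ by (auto simp: turn_repeat)
      then show ?thesis using fixing[OF w wa _ zQ] idN by simp
    next
      case False
      then have X: "X = {y, x, z}" using xy z by (auto simp: X_def)
      let ?s = "shift a y x z"
      let ?S = "translation a ?s" and ?Z = "translation a z"
      have sQ: "?s \<in> Q" using Q xyQ zQ by simp
      have sN: "?S \<in> N" using shiftN[OF X] .
      have "?w z = a \<star> (?s \<star> z)" using wq[OF zQ] turn_eq_shift Q xyQ zQ by simp
      then have "Aut.commutator ?w ?Z = translation a (a \<star> (?s \<star> z)) \<circ> translation z a"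
        using commutator_Aut_translation[OF w Q(1) zQ wa] by simp
      also have "\<dots> = translation ?s a \<circ> (translation a z \<circ> translation ?s a \<circ> translation z a)"
        using Q sQ zQ by (simp add: translation_def reflection_star fun_eq_iff)
      also have "\<dots> = inv\<^bsub>Aut\<^esub> ?S \<otimes>\<^bsub>Aut\<^esub> (?Z \<otimes>\<^bsub>Aut\<^esub> inv\<^bsub>Aut\<^esub> ?S \<otimes>\<^bsub>Aut\<^esub> inv\<^bsub>Aut\<^esub> ?Z)"
        using Q sQ zQ by (simp add: inv_translation)
      also have "\<dots> \<in> N"
        using norm[OF TX[OF z]] sN subgroup.m_closed[OF Nsub] subgroup.m_inv_closed[OF Nsub] by blast
      finally show ?thesis .
    qed
  qed
  have "translation a x \<in> N" if "x \<in> X" for x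
    by (rule absorb[OF TX[OF that] translation_cube[OF Q(1) XQ[OF that]] commN[OF that]])
  then have "H \<subseteq> N" unfolding H_def by (intro Aut.generate_subgroup_incl Nsub) auto
  then show ?thesis using Aut.p_subgroup_subset[OF N(1) H] unfolding H_def X_def by simp
qed

text \<open>Two products of two reflections each involve four points, so they lie in the group
  generated by three translations with a common origin. The Baer-Suzuki theorem now extends
  the conclusion from pairs to all of them.\<close>

lemma p_subgroup_translations:
  assumes fin: "finite Q"
  shows "Aut.p_subgroup 3 (generate Aut {translation x y | x y. x \<in> Q \<and> y \<in> Q})"
proof (rule Aut.baer_suzuki)
  let ?K = "{translation x y | x y. x \<in> Q \<and> y \<in> Q}"
  show "?K \<subseteq> carrier Aut" using translation_in_Aut by blast
  fix f g assume "f \<in> ?K" "g \<in> ?K"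
  then obtain a b c e where fg: "f = translation a b" "g = translation c e" and Q: "a \<in> Q" "b \<in> Q" "c \<in> Q" "e \<in> Q" by blast
  let ?H = "generate Aut (translation a ` {b, c, e})"
  have H: "subgroup ?H Aut" using Q translation_in_Aut by (intro Aut.generate_is_subgroup) blast
  have T: "translation a x \<in> ?H" if "x \<in> {b, c, e}" for x using that by (intro generate.incl) blast
  have "g = translation a e \<otimes>\<^bsub>Aut\<^esub> inv\<^bsub>Aut\<^esub> translation a c"
    unfolding fg using Q by (simp add: inv_translation) (simp add: translation_def fun_eq_iff)
  then have "{f, g} \<subseteq> ?H" using T fg subgroup.m_closed[OF H] subgroup.m_inv_closed[OF H] by auto
  then have "generate Aut {f, g} \<subseteq> ?H" by (rule Aut.generate_subgroup_incl[OF _ H])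
  moreover have "subgroup (generate Aut {f, g}) Aut"
    using fg Q translation_in_Aut by (intro Aut.generate_is_subgroup) blast
  ultimately show "Aut.p_subgroup 3 (generate Aut {f, g})"
    using Aut.p_subgroup_subset[OF p_subgroup_three_translations[OF fin Q]] by blast
next
  fix g f assume g: "g \<in> carrier Aut" and "f \<in> {translation x y | x y. x \<in> Q \<and> y \<in> Q}"
  then obtain x y where f: "f = translation x y" "x \<in> Q" "y \<in> Q" by blast
  have gQ: "g x \<in> Q" "g y \<in> Q" using g f by (simp_all add: permutes_in_image)
  have "g \<otimes>\<^bsub>Aut\<^esub> f = translation (g x) (g y) \<otimes>\<^bsub>Aut\<^esub> g"
    using Aut_comp_reflection[OF g f(2)] Aut_comp_reflection[OF g f(3)] f(1) by (simp add: translation_def fun_eq_iff)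
  then have "g \<otimes>\<^bsub>Aut\<^esub> f \<otimes>\<^bsub>Aut\<^esub> inv\<^bsub>Aut\<^esub> g = translation (g x) (g y)"
    using g translation_in_Aut[OF gQ] by (simp add: Aut.m_assoc del: Aut_simps)
  then show "g \<otimes>\<^bsub>Aut\<^esub> f \<otimes>\<^bsub>Aut\<^esub> inv\<^bsub>Aut\<^esub> g \<in> {translation x y | x y. x \<in> Q \<and> y \<in> Q}" using gQ by blast
qed (use fin finite_Aut in auto)

text \<open>The \<open>3\<close>-group generated by the products of two reflections acts transitively, since
  \<open>S\<^bsub>a \<star> b\<^esub> S\<^bsub>a\<^esub>\<close> takes \<open>a\<close> to \<open>b\<close>; so the order of \<open>Q\<close> divides a power of \<open>3\<close>.\<close>

lemma card_power_of_3:
  assumes fin: "finite Q" and ne: "Q \<noteq> {}"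
  shows "\<exists>m. card Q = 3 ^ m"
proof -
  let ?K = "{translation x y | x y. x \<in> Q \<and> y \<in> Q}"
  define P where "P = generate Aut ?K"
  have P3: "Aut.p_subgroup 3 P" unfolding P_def by (rule p_subgroup_translations[OF fin])
  have P: "subgroup P Aut" using P3 by (simp add: Aut.p_subgroup_def)
  have PG: "group (Aut\<lparr>carrier := P\<rparr>)" by (rule Aut.subgroup_imp_group[OF P])
  have PQ: "f x \<in> Q" if "f \<in> P" "x \<in> Q" for f x
    using subgroup.mem_carrier[OF P that(1)] that(2) by (simp add: permutes_in_image)
  let ?\<phi> = "\<lambda>f. \<lambda>x\<in>Q. f x"
  have act: "group_action (Aut\<lparr>carrier := P\<rparr>) Q ?\<phi>"
    by (rule group.group_actionI[OF PG, where act = "\<lambda>f x. f x"]) (auto simp: PQ)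
  obtain a where a: "a \<in> Q" using ne by blast
  have "orbit (Aut\<lparr>carrier := P\<rparr>) ?\<phi> a = Q"
  proof
    show "orbit (Aut\<lparr>carrier := P\<rparr>) ?\<phi> a \<subseteq> Q" using a PQ by (auto simp: orbit_def)
    show "Q \<subseteq> orbit (Aut\<lparr>carrier := P\<rparr>) ?\<phi> a"
    proof
      fix b assume b: "b \<in> Q"
      have "translation a (a \<star> b) \<in> P" unfolding P_def using a b closed by (intro generate.incl) blast
      moreover have "translation a (a \<star> b) a = b"
        using a b comm[of "a \<star> b" a] by (simp add: translation_def reflection_def)
      ultimately show "b \<in> orbit (Aut\<lparr>carrier := P\<rparr>) ?\<phi> a" using a
        by (auto simp: orbit_def intro!: exI[of _ "translation a (a \<star> b)"])
    qed
  qed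
  then have "card Q dvd card P" using group.orbit_card_dvd[OF PG act a] by (simp add: order_def)
  moreover obtain k where "card P = 3 ^ k"
    using Aut.card_p_subgroup[OF finite_Aut[OF fin] _ P3] by auto
  ultimately show ?thesis using divides_primepow_nat[of 3 "card Q" k] by auto
qed

end

theorem theorem5:
  fixes Q :: "'a set" and kop :: "'a \<Rightarrow> 'a \<Rightarrow> 'a"
  assumes "commutative_kei Q kop"
    and "finite Q"
    and "Q \<noteq> {}"
  shows "\<exists>m::nat. card Q = 3 ^ m"
  using commutative_kei.card_power_of_3[OF assms] .

end
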